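(* (i) The Integral Conjecture is equivalent to the Strong Integral Conjecture. (ii) The Image Conjecture for classical univariate orthogonal polynomials is equivalent to the Strong Image Conjecture for classical univariate orthogonal polynomials. Here the four conjectures are the following assertions. Integral Conjecture: for every open subset $B\subset\mathbb R$ and every positive measure $\sigma$ on $B$ such that $\int_B g\,d\sigma$ exists and is finite for all $g\in\mathbb C[t]$, the subspace $V_B(\sigma)=\{f\in\mathbb C[t] : \int_B f\,d\sigma=0\}$ is a Mathieu subspace of $\mathbb C[t]$. Strong Integral Conjecture: for every such pair $(B,\sigma)$ for which $\sigma$ is not an atomic measure supported at finitely many points, $\mathfrak r(V_B(\sigma))=\{0\}$. Image Conjecture for classical orthogonal polynomials: for every classical operator $\Lambda$, $\mathrm{Im}'\Lambda$ is a Mathieu subspace of $\mathbb C[t]$. Strong Image Conjecture for classical orthogonal polynomials: for every classical operator $\Lambda$ with $1\notin\mathrm{Im}'\Lambda$, $\mathfrak r(\mathrm{Im}'\Lambda)=\{0\}$.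
   Context: For a subset $V$ of $\mathbb C[t]$, $\mathfrak r(V)=\{f\in\mathbb C[t] : f^m\in V \text{ for all sufficiently large } m\}$. A $\mathbb C$-subspace $V$ of $\mathbb C[t]$ is a Mathieu subspace if for every $f\in\mathfrak r(V)$ and every $g\in\mathbb C[t]$ there exists $N$ such that $f^m g\in V$ for all $m\ge N$. A measure $\sigma$ on $B$ is atomic and supported at finitely many points if there is a finite (possibly empty) set of points $r_i\in B$ with $\sigma(\{r_i\})>0$ for each $i$ such that $\sigma(U)=\sum_{r_i\in U}\sigma(\{r_i\})$ for every (measurable) $U\subset B$. The classical operators $\Lambda$, acting from $\mathbb C[t]$ into rational functions of $t$, are: $\partial_t-2t$ (Hermite); $\partial_t+(\alpha t^{-1}-1)$ with real $\alpha>-1$ (generalized Laguerre); and $\partial_t-\alpha(1-t)^{-1}+\beta(1+t)^{-1}$ with real $\alpha,\beta>-1$ (Jacobi). Here $\partial_t=d/dt$, and $\mathrm{Im}'\Lambda:=\mathbb C[t]\cap\Lambda(\mathbb C[t])$. *)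

theory Defs
  imports
    "HOL-Analysis.Analysis"
    "HOL-Computational_Algebra.Computational_Algebra"
begin

interpretation complex_poly: vector_space "smult :: complex \<Rightarrow> complex poly \<Rightarrow> complex poly"
  by standard (simp_all add: smult_add_right smult_add_left)

definition radical_set :: "complex poly set \<Rightarrow> complex poly set" where
  "radical_set V = {f. \<exists>N. \<forall>m\<ge>N. f ^ m \<in> V}"

definition mathieu_subspace :: "complex poly set \<Rightarrow> bool" where
  "mathieu_subspace V \<longleftrightarrow>
     complex_poly.subspace V \<and>
     (\<forall>f\<in>radical_set V. \<forall>g. \<exists>N. \<forall>m\<ge>N. f ^ m * g \<in> V)"

text \<open>
  A positive measure on \<open>B\<close> is read as a Borel measure on \<open>B\<close>; the equation on \<open>sets\<close> also forces
  \<open>space \<sigma> = B\<close>. Applied to the constant polynomial 1, the integrability condition makes \<open>\<sigma>\<close> finite.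
\<close>

definition admissible_measure :: "real set \<Rightarrow> real measure \<Rightarrow> bool" where
  "admissible_measure B \<sigma> \<longleftrightarrow>
     open B \<and> sets \<sigma> = sets (restrict_space borel B) \<and>
     (\<forall>g :: complex poly. integrable \<sigma> (\<lambda>x. poly g (complex_of_real x)))"

definition integral_kernel :: "real measure \<Rightarrow> complex poly set" where
  "integral_kernel \<sigma> = {f. (LINT x|\<sigma>. poly f (complex_of_real x)) = 0}"

text \<open>The set \<open>R\<close> may be empty, so the zero measure is included.\<close>

definition finitely_atomic :: "real measure \<Rightarrow> bool" where
  "finitely_atomic \<sigma> \<longleftrightarrow>
     (\<exists>R. finite R \<and> R \<subseteq> space \<sigma> \<and> (\<forall>r\<in>R. emeasure \<sigma> {r} > 0) \<and>
        (\<forall>U\<in>sets \<sigma>. emeasure \<sigma> U = (\<Sum>r\<in>R \<inter> U. emeasure \<sigma> {r})))"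

definition integral_conjecture :: bool where
  "integral_conjecture \<longleftrightarrow>
     (\<forall>B \<sigma>. admissible_measure B \<sigma> \<longrightarrow> mathieu_subspace (integral_kernel \<sigma>))"

definition strong_integral_conjecture :: bool where
  "strong_integral_conjecture \<longleftrightarrow>
     (\<forall>B \<sigma>. admissible_measure B \<sigma> \<and> \<not> finitely_atomic \<sigma> \<longrightarrow>
        radical_set (integral_kernel \<sigma>) = {0})"

text \<open>Rational functions are elements of \<open>complex poly fract\<close>, the fraction field of \<open>\<complex>[t]\<close>.\<close>

abbreviation rat_var :: "complex poly fract" where
  "rat_var \<equiv> to_fract [:0, 1:]"

abbreviation rat_const :: "real \<Rightarrow> complex poly fract" where
  "rat_const c \<equiv> to_fract [:complex_of_real c:]"

text \<open>The operator \<open>\<partial>\<^sub>t + a\<close>, where \<open>a\<close> acts by multiplication.\<close>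

definition deriv_plus :: "complex poly fract \<Rightarrow> complex poly \<Rightarrow> complex poly fract" where
  "deriv_plus a p = to_fract (pderiv p) + a * to_fract p"

definition hermite_op :: "complex poly \<Rightarrow> complex poly fract" where
  "hermite_op = deriv_plus (- (2 * rat_var))"

definition laguerre_op :: "real \<Rightarrow> complex poly \<Rightarrow> complex poly fract" where
  "laguerre_op \<alpha> = deriv_plus (rat_const \<alpha> * inverse rat_var - 1)"

definition jacobi_op :: "real \<Rightarrow> real \<Rightarrow> complex poly \<Rightarrow> complex poly fract" where
  "jacobi_op \<alpha> \<beta> =
     deriv_plus (- (rat_const \<alpha> * inverse (1 - rat_var)) + rat_const \<beta> * inverse (1 + rat_var))"

definition classical_operators :: "(complex poly \<Rightarrow> complex poly fract) set" where
  "classical_operators =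
     {hermite_op} \<union> {laguerre_op \<alpha> | \<alpha>. \<alpha> > -1} \<union> {jacobi_op \<alpha> \<beta> | \<alpha> \<beta>. \<alpha> > -1 \<and> \<beta> > -1}"

definition poly_image :: "(complex poly \<Rightarrow> complex poly fract) \<Rightarrow> complex poly set" where
  "poly_image \<Lambda> = {p. to_fract p \<in> range \<Lambda>}"

definition classical_image_conjecture :: bool where
  "classical_image_conjecture \<longleftrightarrow> (\<forall>\<Lambda>\<in>classical_operators. mathieu_subspace (poly_image \<Lambda>))"

definition strong_classical_image_conjecture :: bool where
  "strong_classical_image_conjecture \<longleftrightarrow>
     (\<forall>\<Lambda>\<in>classical_operators. 1 \<notin> poly_image \<Lambda> \<longrightarrow> radical_set (poly_image \<Lambda>) = {0})"

end

theory Submission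
  imports Defs "HOL-Computational_Algebra.Field_as_Ring"
begin

text \<open>
  Both equivalences hold for each measure and each operator separately, and for the same reason.

  Write \<open>V\<close> for the subspace in question. If the radical of \<open>V\<close> is zero, then \<open>V\<close> is trivially Mathieu. If
  \<open>V\<close> is Mathieu and \<open>f\<close> lies in its radical, then \<open>V\<close> contains the whole ideal \<open>f ^ N \<complex>[t]\<close> for some \<open>N\<close>,
  because \<open>\<complex>[t]\<close> is a finitely generated module over \<open>\<complex>[f]\<close> for nonconstant \<open>f\<close>
  (\<open>mathieu_radical_power_mem_multiplier_ideal\<close>). It remains to see that \<open>V\<close> contains no nonzero ideal
  outside the exceptional cases, and that \<open>V\<close> is Mathieu in these cases.

  For the kernel of \<open>\<integral> \<cdot> d\<sigma>\<close>, a nonzero ideal contains some \<open>h\<close> together with \<open>h\<close> times its conjugate, so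
  \<open>\<integral> \<bar>h\<bar>\<^sup>2 d\<sigma> = 0\<close>; then \<open>\<sigma>\<close> is carried by the zeros of \<open>h\<close> and is finitely atomic
  (\<open>finitely_atomic_if_kernel_contains_ideal\<close>). If \<open>\<sigma>\<close> is finitely atomic, vanishing of all high power
  sums with positive weights forces an element of the radical to vanish at the atoms
  (\<open>positive_power_sums_zero_imp\<close>).

  For the image of a classical operator the argument is purely algebraic. The image contains all
  \<open>w p' + \<tau> p\<close>, where \<open>(w, \<tau>)\<close> is \<open>(1, -2t)\<close>, \<open>(t, \<alpha> + 1 - t)\<close> or \<open>(1 - t\<^sup>2, \<beta> - \<alpha> - (\<alpha> + \<beta> + 2) t)\<close>. The
  largest ideal inside \<open>V\<close> is therefore stable under \<open>w \<partial>\<^sub>t\<close>. If it is nonzero, it contains a power of \<open>w\<close>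
  (\<open>pearson_multiplier_ideal_contains_power\<close>), and the exponent can be lowered to zero
  (\<open>pearson_multiplier_ideal_power_descent\<close>), so that \<open>1 \<in> V\<close>. In the exceptional case \<open>1 \<in> V\<close>, a count of
  degrees gives \<open>V = \<complex>[t]\<close> (\<open>pearson_subspace_with_one\<close>).
\<close>

section \<open>Mathieu subspaces and the ideals they contain\<close>

text \<open>
  The largest ideal of \<open>\<complex>[t]\<close> contained in \<open>V\<close>, if \<open>V\<close> is a subspace. It is nonzero as soon as \<open>V\<close> is
  Mathieu and has a nonzero radical.
\<close>

definition multiplier_ideal :: "complex poly set \<Rightarrow> complex poly set" where
  "multiplier_ideal V = {h. \<forall>g. h * g \<in> V}"

lemma multiplier_ideal_mult: "h \<in> multiplier_ideal V \<Longrightarrow> h * g \<in> multiplier_ideal V"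
  by (simp add: multiplier_ideal_def mult.assoc)

lemma multiplier_ideal_add:
  assumes "complex_poly.subspace V" "h \<in> multiplier_ideal V" "k \<in> multiplier_ideal V"
  shows "h + k \<in> multiplier_ideal V"
  using assms by (simp add: multiplier_ideal_def distrib_right complex_poly.subspace_add)

lemma one_mem_multiplier_ideal_imp: "1 \<in> multiplier_ideal V \<Longrightarrow> p \<in> V"
  by (simp add: multiplier_ideal_def)

lemma zero_mem_radical_set:
  assumes "complex_poly.subspace V"
  shows "0 \<in> radical_set V"
proof -
  have "\<forall>m\<ge>1. (0 :: complex poly) ^ m \<in> V"
    using assms by (simp add: power_0_left complex_poly.subspace_0)
  then show ?thesis unfolding radical_set_def by blast
qed

lemma mathieu_subspace_if_radical_trivial:
  assumes "complex_poly.subspace V" "radical_set V = {0}"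
  shows "mathieu_subspace V"
proof -
  have "\<forall>m\<ge>1. (0 :: complex poly) ^ m * g \<in> V" for g
    using assms(1) by (simp add: power_0_left complex_poly.subspace_0)
  then show ?thesis
    using assms unfolding mathieu_subspace_def by (metis singletonD)
qed

text \<open>
  In a Mathieu subspace the bound \<open>N\<close> with \<open>f ^ m * g \<in> V\<close> for \<open>m \<ge> N\<close> may depend on \<open>g\<close>. In one variable it
  can be made uniform: \<open>\<complex>[t]\<close> is generated over \<open>\<complex>[f]\<close> by the finitely many monomials of degree at most
  \<open>degree f\<close>, and the powers of \<open>f\<close> that multiply a generator are absorbed by the exponent \<open>m\<close>.
\<close>

lemma mathieu_radical_power_mem_multiplier_ideal:
  assumes V: "mathieu_subspace V" and f: "f \<in> radical_set V"
  shows "\<exists>N. f ^ N \<in> multiplier_ideal V"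
proof -
  have sub: "complex_poly.subspace V"
    using V by (simp add: mathieu_subspace_def)
  obtain M where M: "\<And>g m. m \<ge> M g \<Longrightarrow> f ^ m * g \<in> V"
    using V f unfolding mathieu_subspace_def by metis
  show ?thesis
  proof (cases "degree f = 0")
    case True
    then obtain c where c: "f = [:c:]" by (auto elim: degree_eq_zeroE)
    show ?thesis
    proof (cases "c = 0")
      case True
      then have "f ^ 1 \<in> multiplier_ideal V"
        using c sub by (simp add: multiplier_ideal_def complex_poly.subspace_0)
      then show ?thesis by blast
    next
      case False
      \<comment> \<open>Powers of a nonzero constant are invertible scalars, so \<open>V\<close> is everything.\<close>
      have "f ^ 0 * g \<in> V" for g
      proof -
        have "smult (inverse (c ^ M g)) (f ^ M g * g) \<in> V"
          using M[of g "M g"] sub by (simp add: complex_poly.subspace_scale)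
        moreover have "smult (inverse (c ^ M g)) (f ^ M g * g) = g"
          using False by (simp add: c poly_const_pow)
        ultimately show ?thesis by simp
      qed
      then show ?thesis unfolding multiplier_ideal_def by blast
    qed
  next
    case False
    define N where "N = Max ((\<lambda>i. M (monom 1 i)) ` {..degree f})"
    have low: "f ^ m * r \<in> V" if "m \<ge> N" "degree r \<le> degree f" for m r
    proof -
      have "f ^ m * monom 1 i \<in> V" if "i \<le> degree f" for i
      proof -
        have "M (monom 1 i) \<le> N"
          unfolding N_def using that by (intro Max_ge) auto
        with \<open>m \<ge> N\<close> show ?thesis by (intro M) simp
      qed
      then have "(\<Sum>i\<le>degree f. smult (coeff r i) (f ^ m * monom 1 i)) \<in> V"
        using sub by (intro complex_poly.subspace_sum complex_poly.subspace_scale) auto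
      moreover have "(\<Sum>i\<le>degree f. smult (coeff r i) (f ^ m * monom 1 i)) =
          f ^ m * (\<Sum>i\<le>degree f. monom (coeff r i) i)"
        by (simp add: sum_distrib_left smult_monom flip: mult_smult_right)
      ultimately show ?thesis
        using that by (simp add: poly_as_sum_of_monoms')
    qed
    have "f ^ m * g \<in> V" if "m \<ge> N" for m g
      using that
    proof (induction "degree g" arbitrary: g m rule: less_induct)
      case less
      show ?case
      proof (cases "degree g \<le> degree f")
        case True
        then show ?thesis using low less.prems by simp
      next
        case deg: False
        \<comment> \<open>Peel off one power of \<open>f\<close> and raise the exponent by one.\<close>
        have f0: "f \<noteq> 0" using False by auto
        have "degree (g div f) < degree g"
          using deg False by (intro degree_div_less) auto
        then have "f ^ Suc m * (g div f) \<in> V"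
          using less by (intro less.hyps) auto
        moreover have "f ^ m * (g mod f) \<in> V"
          using degree_mod_less[of f g] f0 less.prems by (intro low) auto
        ultimately have "f ^ Suc m * (g div f) + f ^ m * (g mod f) \<in> V"
          using sub by (simp add: complex_poly.subspace_add)
        moreover have "f ^ Suc m * (g div f) + f ^ m * (g mod f) = f ^ m * (f * (g div f) + g mod f)"
          by (simp only: power_Suc2 distrib_left mult.assoc)
        ultimately show ?thesis by simp
      qed
    qed
    then have "f ^ N \<in> multiplier_ideal V"
      unfolding multiplier_ideal_def by simp
    then show ?thesis by blast
  qed
qed

section \<open>Subspaces containing the range of a Pearson operator\<close>

lemma no_common_root_imp_bezout:
  fixes a b :: "complex poly"
  assumes "\<And>x. poly a x = 0 \<Longrightarrow> poly b x \<noteq> 0"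
  obtains u v where "u * a + v * b = 1"
proof -
  have "coprime a b"
  proof (rule coprimeI)
    fix d assume d: "d dvd a" "d dvd b"
    have "poly d x \<noteq> 0" for x
      using d assms[of x] by (auto elim!: dvdE)
    then have "constant (poly d)"
      using fundamental_theorem_of_algebra by blast
    then have "degree d = 0" by (simp add: constant_degree)
    moreover have "d \<noteq> 0" using \<open>\<And>x. poly d x \<noteq> 0\<close> by auto
    ultimately show "is_unit d" by (simp add: is_unit_iff_degree)
  qed
  then show ?thesis
    using that bezout_coefficients_fst_snd[of a b] by (metis coprime_imp_gcd_eq_1)
qed

text \<open>
  If a weight \<open>\<rho>\<close> satisfies the Pearson equation \<open>(w \<rho>)' = \<tau> \<rho>\<close>, then \<open>(w p \<rho>)'\<close> is \<open>\<rho>\<close> times this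
  polynomial, so its integral against \<open>\<rho>\<close> vanishes up to boundary terms. The classical weights
  are all of this kind.
\<close>

definition pearson_op :: "complex poly \<Rightarrow> complex poly \<Rightarrow> complex poly \<Rightarrow> complex poly" where
  "pearson_op w \<tau> p = w * pderiv p + \<tau> * p"

text \<open>
  The Leibniz rule: applied to \<open>h * g\<close>, the operator produces the wanted term \<open>w * pderiv h * g\<close> and
  otherwise only multiples of \<open>h\<close>.
\<close>

lemma pearson_multiplier_ideal_deriv:
  assumes sub: "complex_poly.subspace V" and V: "range (pearson_op w \<tau>) \<subseteq> V"
    and h: "h \<in> multiplier_ideal V"
  shows "w * pderiv h \<in> multiplier_ideal V"
  unfolding multiplier_ideal_def
proof safe
  fix g
  have "pearson_op w \<tau> (h * g) - h * (w * pderiv g + \<tau> * g) \<in> V"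
    using V h sub by (intro complex_poly.subspace_diff) (auto simp: multiplier_ideal_def)
  then show "w * pderiv h * g \<in> V"
    by (simp add: pearson_op_def pderiv_mult algebra_simps)
qed

text \<open>
  A generator \<open>k\<close> of the ideal divides \<open>w * pderiv k\<close>, since the ideal is stable under \<open>w \<partial>\<^sub>t\<close>. This forces
  every root of \<open>k\<close> to be a root of \<open>w\<close>, and then \<open>k\<close> divides a power of \<open>w\<close>.
\<close>

lemma pearson_multiplier_ideal_contains_power:
  assumes sub: "complex_poly.subspace V" and V: "range (pearson_op w \<tau>) \<subseteq> V"
    and h: "h \<in> multiplier_ideal V" "h \<noteq> 0"
  shows "\<exists>n. w ^ n \<in> multiplier_ideal V"
proof -
  obtain k where k: "k \<in> multiplier_ideal V" "k \<noteq> 0"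
    and least: "\<And>p. p \<in> multiplier_ideal V \<Longrightarrow> p \<noteq> 0 \<Longrightarrow> degree k \<le> degree p"
    using h ex_has_least_nat[of "\<lambda>p. p \<in> multiplier_ideal V \<and> p \<noteq> 0" h degree] by blast
  have "w * pderiv k mod k = w * pderiv k + k * (- (w * pderiv k div k))"
    by (simp add: minus_mult_div_eq_mod [symmetric])
  also have "\<dots> \<in> multiplier_ideal V"
    using sub k V by (intro multiplier_ideal_add multiplier_ideal_mult pearson_multiplier_ideal_deriv)
  finally have "w * pderiv k mod k = 0"
    using least k(2) degree_mod_less[of k "w * pderiv k"] by fastforce
  then have dvd: "k dvd w * pderiv k" by auto
  \<comment> \<open>Differentiation lowers the order of a root by exactly one, so \<open>w\<close> must make up for it.\<close>
  have "poly w x = 0" if x: "poly k x = 0" for x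
  proof (rule ccontr)
    assume w: "poly w x \<noteq> 0"
    have k': "pderiv k \<noteq> 0"
    proof
      assume "pderiv k = 0"
      then obtain c where "k = [:c:]" by (auto simp: pderiv_eq_0_iff elim: degree_eq_zeroE)
      then show False using x k(2) by simp
    qed
    have "w * pderiv k \<noteq> 0" using w k' by auto
    then have "order x k \<le> order x w + order x (pderiv k)"
      using dvd by (metis dvd_imp_order_le order_mult)
    moreover have "order x w = 0" using w by (simp add: order_0I)
    moreover have "order x k = Suc (order x (pderiv k))"
      using k(2) x k' by (intro order_pderiv) (auto simp: order_root)
    ultimately show False by simp
  qed
  then have "k dvd w ^ degree k"
    using k(2) nullstellensatz_univariate[of k w] by blast
  then have "w ^ degree k \<in> multiplier_ideal V"
    using k(1) by (auto elim!: dvdE intro: multiplier_ideal_mult)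
  then show ?thesis by blast
qed

text \<open>
  Applying the operator to \<open>w ^ n * g\<close> shows that \<open>w ^ n * (n * pderiv w + \<tau>)\<close> lies in the ideal together
  with \<open>w ^ (n + 1)\<close>. If the two cofactors \<open>w\<close> and \<open>n * pderiv w + \<tau>\<close> of \<open>w ^ n\<close> are coprime, then \<open>w ^ n\<close>
  lies in the ideal as well.
\<close>

lemma pearson_multiplier_ideal_power_descent:
  assumes sub: "complex_poly.subspace V" and V: "range (pearson_op w \<tau>) \<subseteq> V"
    and ndeg: "\<And>x. poly w x = 0 \<Longrightarrow> poly (of_nat n * pderiv w + \<tau>) x \<noteq> 0"
    and pow: "w ^ Suc n \<in> multiplier_ideal V"
  shows "w ^ n \<in> multiplier_ideal V"
proof -
  let ?c = "of_nat n * pderiv w + \<tau>"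
  have "w ^ n * ?c \<in> multiplier_ideal V"
    unfolding multiplier_ideal_def
  proof safe
    fix g
    have "w * pderiv (w ^ n) = of_nat n * pderiv w * w ^ n"
    proof (cases n)
      case (Suc k)
      then show ?thesis
        unfolding Suc pderiv_power_Suc by (simp add: of_nat_poly algebra_simps)
    qed simp
    then have "w ^ n * ?c * g = pearson_op w \<tau> (w ^ n * g) - w ^ Suc n * pderiv g"
      by (simp add: pearson_op_def pderiv_mult algebra_simps)
    also have "\<dots> \<in> V"
      using V pow sub by (intro complex_poly.subspace_diff) (auto simp: multiplier_ideal_def)
    finally show "w ^ n * ?c * g \<in> V" .
  qed
  moreover obtain u v where uv: "u * w + v * ?c = 1"
    using ndeg no_common_root_imp_bezout by metis
  ultimately have "w ^ Suc n * u + (w ^ n * ?c) * v \<in> multiplier_ideal V"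
    using sub pow by (blast intro: multiplier_ideal_add multiplier_ideal_mult)
  also have "w ^ Suc n * u + (w ^ n * ?c) * v = w ^ n * (u * w + v * ?c)"
    by (simp add: algebra_simps)
  finally show ?thesis using uv by simp
qed

text \<open>
  The range of the operator has codimension at most one: the operator sends \<open>t ^ n\<close> to a polynomial
  of degree \<open>n + 1\<close>, whose leading coefficient is the quantity assumed to be nonzero.
\<close>

lemma pearson_range_plus_constants:
  assumes "degree w \<le> 2" "degree \<tau> \<le> 1"
    and lead: "\<And>n. of_nat n * coeff w 2 + coeff \<tau> 1 \<noteq> 0"
  shows "\<exists>p c. g = pearson_op w \<tau> p + [:c:]"
proof (induction "degree g" arbitrary: g rule: less_induct)
  case less
  show ?case
  proof (cases "degree g")
    case 0
    then obtain c where "g = [:c:]" by (auto elim: degree_eq_zeroE)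
    then have "g = pearson_op w \<tau> 0 + [:c:]" by (simp add: pearson_op_def)
    then show ?thesis by blast
  next
    case (Suc n)
    define a where "a = coeff g (Suc n) / (of_nat n * coeff w 2 + coeff \<tau> 1)"
    define q where "q = pearson_op w \<tau> (monom a n)"
    have deg_deriv: "degree (w * pderiv (monom a n)) \<le> Suc n"
    proof (cases n)
      case 0
      then show ?thesis by (simp add: pderiv_monom)
    next
      case (Suc k)
      then have "degree (pderiv (monom a n)) \<le> k"
        by (simp add: pderiv_monom degree_monom_le)
      then show ?thesis
        using degree_mult_le[of w "pderiv (monom a n)"] assms(1) Suc by simp
    qed
    have deg_mult: "degree (\<tau> * monom a n) \<le> Suc n"
      using degree_mult_le[of \<tau> "monom a n"] degree_monom_le[of a n] assms(2) by simp
    have degq: "degree q \<le> Suc n"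
      unfolding q_def pearson_op_def using deg_deriv deg_mult by (rule degree_add_le)
    have c1: "coeff (w * pderiv (monom a n)) (Suc n) = of_nat n * a * coeff w 2"
      by (cases n) (simp_all add: pderiv_monom mult.commute[of w] coeff_monom_mult numeral_2_eq_2)
    have c2: "coeff (\<tau> * monom a n) (Suc n) = a * coeff \<tau> 1"
      by (simp add: mult.commute[of \<tau>] coeff_monom_mult)
    have "coeff q (Suc n) = a * (of_nat n * coeff w 2 + coeff \<tau> 1)"
      unfolding q_def pearson_op_def coeff_add c1 c2 by (simp add: algebra_simps)
    then have "coeff (g - q) (Suc n) = 0"
      using lead[of n] by (simp add: a_def)
    moreover have "degree (g - q) \<le> Suc n"
      using Suc degq by (intro degree_diff_le) auto
    ultimately have "degree (g - q) < degree g"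
      using Suc by (metis eq_zero_or_degree_less degree_0 zero_less_Suc)
    then obtain p c where "g - q = pearson_op w \<tau> p + [:c:]"
      using less by blast
    then have "g = pearson_op w \<tau> (monom a n + p) + [:c:]"
      by (simp add: q_def pearson_op_def pderiv_add algebra_simps)
    then show ?thesis by blast
  qed
qed

text \<open>
  The third condition makes the operator raise degrees by exactly one; the fourth is the
  coprimality that lets powers of \<open>w\<close> descend to \<open>1\<close>. In the Laguerre and Jacobi cases this coprimality is
  where the bounds \<open>\<alpha> > -1\<close> and \<open>\<beta> > -1\<close> enter; in the Jacobi case the third condition uses them too.
\<close>

definition nondegenerate_pearson_pair :: "complex poly \<Rightarrow> complex poly \<Rightarrow> bool" where
  "nondegenerate_pearson_pair w \<tau> \<longleftrightarrow>
     degree w \<le> 2 \<and> degree \<tau> \<le> 1 \<and>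
     (\<forall>n. of_nat n * coeff w 2 + coeff \<tau> 1 \<noteq> 0) \<and>
     (\<forall>n x. poly w x = 0 \<longrightarrow> poly (of_nat n * pderiv w + \<tau>) x \<noteq> 0)"

lemma pearson_subspace_with_one:
  assumes "nondegenerate_pearson_pair w \<tau>" and sub: "complex_poly.subspace V"
    and V: "range (pearson_op w \<tau>) \<subseteq> V" and one: "1 \<in> V"
  shows "V = UNIV"
proof -
  have "g \<in> V" for g
  proof -
    obtain p c where "g = pearson_op w \<tau> p + [:c:]"
      using assms(1) pearson_range_plus_constants[of w \<tau> g]
      by (auto simp: nondegenerate_pearson_pair_def)
    moreover have "[:c:] \<in> V"
      using complex_poly.subspace_scale[OF sub one, of c] by simp
    moreover have "pearson_op w \<tau> p \<in> V" using V by blast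
    ultimately show ?thesis using sub by (simp add: complex_poly.subspace_add)
  qed
  then show ?thesis by blast
qed

lemma pearson_subspace_with_ideal:
  assumes "nondegenerate_pearson_pair w \<tau>" and sub: "complex_poly.subspace V"
    and V: "range (pearson_op w \<tau>) \<subseteq> V" and h: "h \<in> multiplier_ideal V" "h \<noteq> 0"
  shows "V = UNIV"
proof -
  obtain n where "w ^ n \<in> multiplier_ideal V"
    using pearson_multiplier_ideal_contains_power[OF sub V h] by blast
  then have "w ^ 0 \<in> multiplier_ideal V"
  proof (induction n)
    case (Suc n)
    then show ?case
      using assms(1) pearson_multiplier_ideal_power_descent[OF sub V, of n]
      by (simp add: nondegenerate_pearson_pair_def)
  qed
  then show ?thesis using one_mem_multiplier_ideal_imp by auto
qed

text \<open>
  If \<open>1 \<in> V\<close>, then \<open>V\<close> is all of \<open>\<complex>[t]\<close> by the codimension bound, hence trivially Mathieu. If \<open>1 \<notin> V\<close>, then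
  \<open>V\<close> contains no nonzero ideal, so being Mathieu means that the radical is zero.
\<close>

lemma pearson_mathieu_iff_radical:
  assumes pair: "nondegenerate_pearson_pair w \<tau>" and sub: "complex_poly.subspace V"
    and V: "range (pearson_op w \<tau>) \<subseteq> V"
  shows "mathieu_subspace V \<longleftrightarrow> (1 \<notin> V \<longrightarrow> radical_set V = {0})"
proof
  assume M: "mathieu_subspace V"
  show "1 \<notin> V \<longrightarrow> radical_set V = {0}"
  proof
    assume "1 \<notin> V"
    have "f = 0" if f: "f \<in> radical_set V" for f
    proof (rule ccontr)
      assume "f \<noteq> 0"
      then have "f ^ N \<noteq> 0" for N by simp
      then have "V = UNIV"
        using mathieu_radical_power_mem_multiplier_ideal[OF M f]
          pearson_subspace_with_ideal[OF pair sub V] by blast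
      with \<open>1 \<notin> V\<close> show False by simp
    qed
    then show "radical_set V = {0}" using zero_mem_radical_set[OF sub] by blast
  qed
next
  assume strong: "1 \<notin> V \<longrightarrow> radical_set V = {0}"
  show "mathieu_subspace V"
  proof (cases "1 \<in> V")
    case True
    then have "V = UNIV" using pearson_subspace_with_one[OF pair sub V] by blast
    then show ?thesis using sub by (simp add: mathieu_subspace_def)
  next
    case False
    then show ?thesis using strong sub mathieu_subspace_if_radical_trivial by blast
  qed
qed

section \<open>The classical operators\<close>

lemma subspace_poly_image_deriv_plus: "complex_poly.subspace (poly_image (deriv_plus a))"
proof -
  have scale: "smult c p = [:c:] * p" for c and p :: "complex poly" by simp
  have "deriv_plus a 0 = 0" by (simp add: deriv_plus_def)
  moreover have "deriv_plus a p + deriv_plus a q = deriv_plus a (p + q)" for p q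
    by (simp add: deriv_plus_def pderiv_add distrib_left)
  moreover have "to_fract [:c:] * deriv_plus a p = deriv_plus a (smult c p)" for p c
    unfolding deriv_plus_def pderiv_smult unfolding scale[of c] to_fract_mult
    by (simp only: distrib_left mult.left_commute)
  ultimately have lin: "deriv_plus a 0 = 0"
    "\<And>p q. deriv_plus a p + deriv_plus a q = deriv_plus a (p + q)"
    "\<And>p c. to_fract [:c:] * deriv_plus a p = deriv_plus a (smult c p)" by blast+
  show ?thesis
    unfolding complex_poly.subspace_def poly_image_def mem_Collect_eq
  proof (intro conjI allI ballI)
    show "to_fract 0 \<in> range (deriv_plus a)"
      using lin(1) by (intro image_eqI[of _ _ 0]) auto
    show "to_fract (p + q) \<in> range (deriv_plus a)"
      if "p \<in> {p. to_fract p \<in> range (deriv_plus a)}" "q \<in> {p. to_fract p \<in> range (deriv_plus a)}" for p q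
      using that lin(2) by auto
    show "to_fract (smult c p) \<in> range (deriv_plus a)"
      if "p \<in> {p. to_fract p \<in> range (deriv_plus a)}" for c p
    proof -
      have "to_fract (smult c p) = to_fract [:c:] * to_fract p"
        unfolding scale by (rule to_fract_mult)
      then show ?thesis using that lin(3) by auto
    qed
  qed
qed

text \<open>
  Restricting \<open>\<partial>\<^sub>t + a\<close> to multiples of a denominator \<open>w\<close> of \<open>a\<close> gives a Pearson operator. Equality can fail:
  if a Laguerre or Jacobi parameter vanishes, the image is all of \<open>\<complex>[t]\<close>. The inclusion holds uniformly
  in the parameters.
\<close>

lemma range_pearson_op_subset_poly_image:
  assumes "a * to_fract w = to_fract (\<tau> - pderiv w)"
  shows "range (pearson_op w \<tau>) \<subseteq> poly_image (deriv_plus a)"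
proof -
  have "to_fract (pearson_op w \<tau> p) = deriv_plus a (w * p)" for p
  proof -
    have "deriv_plus a (w * p) = to_fract (pderiv (w * p)) + (a * to_fract w) * to_fract p"
      by (simp add: deriv_plus_def mult.assoc)
    also have "\<dots> = to_fract (pearson_op w \<tau> p)"
      unfolding assms by (simp add: pearson_op_def pderiv_mult algebra_simps)
    finally show ?thesis by simp
  qed
  then show ?thesis unfolding poly_image_def by auto
qed

lemma hermite_pearson_pair: "nondegenerate_pearson_pair 1 [:0, -2:]"
  by (simp add: nondegenerate_pearson_pair_def)

lemma laguerre_pearson_pair:
  assumes "\<alpha> > -1"
  shows "nondegenerate_pearson_pair [:0, 1:] [:1 + complex_of_real \<alpha>, -1:]"
proof -
  have "of_nat n + (1 + complex_of_real \<alpha>) = complex_of_real (real n + 1 + \<alpha>)" for n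
    by simp
  moreover have "real n + 1 + \<alpha> \<noteq> 0" for n using assms by linarith
  ultimately have "of_nat n + (1 + complex_of_real \<alpha>) \<noteq> 0" for n
    by (metis of_real_eq_0_iff)
  then show ?thesis
    by (simp add: nondegenerate_pearson_pair_def pderiv_pCons numeral_2_eq_2)
qed

lemma jacobi_pearson_pair:
  assumes "\<alpha> > -1" "\<beta> > -1"
  shows "nondegenerate_pearson_pair [:1, 0, -1:]
    [:complex_of_real (\<beta> - \<alpha>), - complex_of_real (\<alpha> + \<beta> + 2):]"
proof -
  let ?t = "[:complex_of_real (\<beta> - \<alpha>), - complex_of_real (\<alpha> + \<beta> + 2):]"
  have lead: "of_nat n * coeff [:1, 0, -1:] 2 + coeff ?t 1 \<noteq> 0" for n
  proof -
    have "of_nat n * coeff [:1, 0, -1:] 2 + coeff ?t 1 = complex_of_real (- (real n + \<alpha> + \<beta> + 2))"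
      by (simp add: numeral_2_eq_2)
    moreover have "- (real n + \<alpha> + \<beta> + 2) \<noteq> 0" using assms by linarith
    ultimately show ?thesis by (metis of_real_eq_0_iff)
  qed
  have roots: "poly (of_nat n * pderiv [:1, 0, -1:] + ?t) x \<noteq> 0" if "poly [:1, 0, -1:] x = 0" for n x
  proof -
    have "(x - 1) * (x + 1) = 0" using that by (simp add: algebra_simps)
    then consider "x = 1" | "x = -1" by (auto simp: add_eq_0_iff2)
    then show ?thesis
    proof cases
      case 1
      then have "poly (of_nat n * pderiv [:1, 0, -1:] + ?t) x = complex_of_real (- 2 * (real n + \<alpha> + 1))"
        by (simp add: pderiv_pCons algebra_simps)
      moreover have "- 2 * (real n + \<alpha> + 1) \<noteq> 0" using assms by simp
      ultimately show ?thesis by (metis of_real_eq_0_iff)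
    next
      case 2
      then have "poly (of_nat n * pderiv [:1, 0, -1:] + ?t) x = complex_of_real (2 * (real n + \<beta> + 1))"
        by (simp add: pderiv_pCons algebra_simps)
      moreover have "2 * (real n + \<beta> + 1) \<noteq> 0" using assms by simp
      ultimately show ?thesis by (metis of_real_eq_0_iff)
    qed
  qed
  show ?thesis
    unfolding nondegenerate_pearson_pair_def using lead roots by simp
qed

lemma classical_operator_contains_pearson_range:
  assumes "\<Lambda> \<in> classical_operators"
  obtains w \<tau> where "nondegenerate_pearson_pair w \<tau>" "complex_poly.subspace (poly_image \<Lambda>)"
    "range (pearson_op w \<tau>) \<subseteq> poly_image \<Lambda>"
proof -
  from assms consider "\<Lambda> = hermite_op" | \<alpha> where "\<alpha> > -1" "\<Lambda> = laguerre_op \<alpha>"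
    | \<alpha> \<beta> where "\<alpha> > -1" "\<beta> > -1" "\<Lambda> = jacobi_op \<alpha> \<beta>"
    by (auto simp: classical_operators_def)
  then show ?thesis
  proof cases
    case 1
    have "- (2 * rat_var) = to_fract [:0, - 2:]"
    proof -
      have "2 * rat_var = to_fract [:0, 1:] + to_fract [:0, 1:]" by (rule mult_2)
      also have "\<dots> = to_fract [:0, 2:]" by (simp flip: to_fract_add)
      finally show ?thesis by (simp flip: to_fract_uminus)
    qed
    then have "- (2 * rat_var) * to_fract 1 = to_fract ([:0, - 2:] - pderiv 1)"
      by simp
    then show ?thesis
      using that hermite_pearson_pair subspace_poly_image_deriv_plus
        range_pearson_op_subset_poly_image unfolding 1 hermite_op_def by blast
  next
    case (2 \<alpha>)
    have "(rat_const \<alpha> * inverse rat_var - 1) * to_fract [:0, 1:] = rat_const \<alpha> - rat_var"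
      by (simp add: left_diff_distrib)
    also have "\<dots> = to_fract ([:1 + complex_of_real \<alpha>, -1:] - pderiv [:0, 1:])"
      by (simp add: pderiv_pCons flip: to_fract_diff)
    finally show ?thesis
      using that laguerre_pearson_pair[OF 2(1)] subspace_poly_image_deriv_plus
        range_pearson_op_subset_poly_image unfolding 2 laguerre_op_def by blast
  next
    case (3 \<alpha> \<beta>)
    have u: "1 - rat_var = to_fract [:1, -1:]" and v: "1 + rat_var = to_fract [:1, 1:]"
      by (simp_all add: one_pCons flip: to_fract_1 to_fract_add to_fract_diff)
    have w: "to_fract [:1, 0, -1:] = to_fract [:1, -1:] * to_fract [:1, 1:]"
      by (simp flip: to_fract_mult)
    have "(- (rat_const \<alpha> * inverse (1 - rat_var)) + rat_const \<beta> * inverse (1 + rat_var))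
        * to_fract [:1, 0, -1:] = - rat_const \<alpha> * to_fract [:1, 1:] + rat_const \<beta> * to_fract [:1, -1:]"
    proof -
      have clear: "(- (a * inverse x) + b * inverse y) * (x * y) = - a * y + b * x"
        if "x \<noteq> 0" "y \<noteq> 0" for a b x y :: "complex poly fract"
        using that by (simp add: field_simps)
      show ?thesis unfolding u v w by (rule clear) simp_all
    qed
    also have "\<dots> = to_fract ([:complex_of_real (\<beta> - \<alpha>), - complex_of_real (\<alpha> + \<beta> + 2):]
        - pderiv [:1, 0, -1:])"
      by (simp add: pderiv_pCons flip: to_fract_mult to_fract_add to_fract_uminus)
    finally show ?thesis
      using that jacobi_pearson_pair[OF 3(1,2)] subspace_poly_image_deriv_plus
        range_pearson_op_subset_poly_image unfolding 3 jacobi_op_def by blast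
  qed
qed

lemma classical_image_conjecture_iff_strong:
  "classical_image_conjecture \<longleftrightarrow> strong_classical_image_conjecture"
  unfolding classical_image_conjecture_def strong_classical_image_conjecture_def
  by (intro ball_cong refl) (metis classical_operator_contains_pearson_range pearson_mathieu_iff_radical)

section \<open>Kernels of integrals\<close>

lemma admissible_singleton_sets:
  assumes "admissible_measure B \<sigma>" "x \<in> space \<sigma>"
  shows "{x} \<in> sets \<sigma>"
proof -
  have "space \<sigma> = B"
    using assms(1) sets_eq_imp_space_eq[of \<sigma> "restrict_space borel B"]
    by (simp add: admissible_measure_def space_restrict_space)
  then show ?thesis
    using assms by (auto simp: admissible_measure_def sets_restrict_space intro!: image_eqI[of _ _ "{x}"])
qed

lemma admissible_integrable_poly:
  assumes "admissible_measure B \<sigma>"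
  shows "integrable \<sigma> (\<lambda>x. poly g (complex_of_real x))"
  using assms by (simp add: admissible_measure_def)

lemma admissible_finite_measure:
  assumes "admissible_measure B \<sigma>"
  shows "finite_measure \<sigma>"
  using admissible_integrable_poly[OF assms, of 1]
  by (auto simp: integrable_iff_bounded less_top intro: finite_measureI)

lemma subspace_integral_kernel:
  assumes "admissible_measure B \<sigma>"
  shows "complex_poly.subspace (integral_kernel \<sigma>)"
  using admissible_integrable_poly[OF assms]
  by (auto simp: complex_poly.subspace_def integral_kernel_def)

text \<open>
  Such a measure lives on the finitely many zeros of \<open>f\<close>; the zeros of measure zero have to be
  discarded to obtain atoms of positive mass.
\<close>

lemma finitely_atomic_if_AE_poly_zero:
  assumes adm: "admissible_measure B \<sigma>" and "f \<noteq> 0"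
    and ae: "AE x in \<sigma>. poly f (complex_of_real x) = 0"
  shows "finitely_atomic \<sigma>"
proof -
  define Z where "Z = {x \<in> space \<sigma>. poly f (complex_of_real x) = 0}"
  have "finite (complex_of_real -` {z. poly f z = 0})"
    using \<open>f \<noteq> 0\<close> by (intro finite_vimageI poly_roots_finite) (auto simp: inj_on_def)
  then have finZ: "finite Z"
    by (rule finite_subset[rotated]) (auto simp: Z_def)
  define R where "R = {x \<in> Z. emeasure \<sigma> {x} > 0}"
  have "emeasure \<sigma> U = (\<Sum>r\<in>R \<inter> U. emeasure \<sigma> {r})" if U: "U \<in> sets \<sigma>" for U
  proof -
    have ZU: "{x} \<in> sets \<sigma>" if "x \<in> Z \<inter> U" for x
      using that admissible_singleton_sets[OF adm] by (simp add: Z_def)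
    then have "(\<Union>x\<in>Z \<inter> U. {x}) \<in> sets \<sigma>"
      using finZ by (intro sets.finite_UN) auto
    then have "Z \<inter> U \<in> sets \<sigma>" by simp
    moreover have "AE x in \<sigma>. x \<in> U \<longleftrightarrow> x \<in> Z \<inter> U"
      using ae by (rule AE_mp) (auto simp: Z_def)
    ultimately have "emeasure \<sigma> U = emeasure \<sigma> (Z \<inter> U)"
      using U by (intro emeasure_eq_AE)
    also have "\<dots> = (\<Sum>r\<in>Z \<inter> U. emeasure \<sigma> {r})"
      using finZ ZU by (intro emeasure_eq_sum_singleton) auto
    also have "\<dots> = (\<Sum>r\<in>R \<inter> U. emeasure \<sigma> {r})"
      using finZ by (intro sum.mono_neutral_right) (auto simp: R_def zero_less_iff_neq_zero)
    finally show ?thesis .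
  qed
  moreover have "finite R" "R \<subseteq> space \<sigma>" "\<forall>r\<in>R. emeasure \<sigma> {r} > 0"
    using finZ finite_subset[of R Z] by (auto simp: R_def Z_def)
  ultimately show ?thesis unfolding finitely_atomic_def by blast
qed

text \<open>
  Multiplying \<open>h\<close> by its conjugate polynomial, which is the complex conjugate of \<open>h\<close> on the real line,
  gives \<open>\<integral> \<bar>h\<bar>\<^sup>2 d\<sigma> = 0\<close>.
\<close>

lemma finitely_atomic_if_kernel_contains_ideal:
  assumes adm: "admissible_measure B \<sigma>" and h: "h \<noteq> 0"
    and mem: "h \<in> multiplier_ideal (integral_kernel \<sigma>)"
  shows "finitely_atomic \<sigma>"
proof -
  have sq: "poly (h * map_poly cnj h) (complex_of_real x)
      = complex_of_real ((cmod (poly h (complex_of_real x)))\<^sup>2)" for x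
    by (simp add: complex_norm_square del: of_real_power)
  have int: "integrable \<sigma> (\<lambda>x. complex_of_real ((cmod (poly h (complex_of_real x)))\<^sup>2))"
    using admissible_integrable_poly[OF adm, of "h * map_poly cnj h"] unfolding sq .
  have "h * map_poly cnj h \<in> integral_kernel \<sigma>"
    using mem by (simp add: multiplier_ideal_def)
  then have "(LINT x|\<sigma>. complex_of_real ((cmod (poly h (complex_of_real x)))\<^sup>2)) = 0"
    unfolding integral_kernel_def mem_Collect_eq sq .
  then have "(LINT x|\<sigma>. (cmod (poly h (complex_of_real x)))\<^sup>2) = 0"
    by (simp only: integral_complex_of_real of_real_eq_0_iff)
  moreover have "integrable \<sigma> (\<lambda>x. (cmod (poly h (complex_of_real x)))\<^sup>2)"
    using int by (simp only: complex_of_real_integrable_eq)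
  ultimately have "AE x in \<sigma>. (cmod (poly h (complex_of_real x)))\<^sup>2 = 0"
    using integral_nonneg_eq_0_iff_AE[of \<sigma> "\<lambda>x. (cmod (poly h (complex_of_real x)))\<^sup>2"] by simp
  then show ?thesis
    using finitely_atomic_if_AE_poly_zero[OF adm h] by simp
qed

lemma integral_finitely_atomic:
  fixes f :: "real \<Rightarrow> complex"
  assumes adm: "admissible_measure B \<sigma>" and R: "finite R" "R \<subseteq> space \<sigma>"
    and atomic: "\<And>U. U \<in> sets \<sigma> \<Longrightarrow> emeasure \<sigma> U = (\<Sum>r\<in>R \<inter> U. emeasure \<sigma> {r})"
    and f: "f \<in> borel_measurable \<sigma>"
  shows "(LINT x|\<sigma>. f x) = (\<Sum>r\<in>R. measure \<sigma> {r} *\<^sub>R f r)"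
proof -
  interpret finite_measure \<sigma>
    using adm by (rule admissible_finite_measure)
  have sing: "{r} \<in> sets \<sigma>" if "r \<in> R" for r
    using that R admissible_singleton_sets[OF adm] by blast
  then have "(\<Union>r\<in>R. {r}) \<in> sets \<sigma>"
    using R by (intro sets.finite_UN) auto
  then have "space \<sigma> - R \<in> sets \<sigma>" by auto
  moreover from this have "emeasure \<sigma> (space \<sigma> - R) = 0"
    by (subst atomic) auto
  ultimately have "AE x in \<sigma>. x \<in> R"
    by (intro AE_I[of _ _ "space \<sigma> - R"]) auto
  then have "AE x in \<sigma>. f x = (\<Sum>r\<in>R. indicator {r} x *\<^sub>R f r)"
    by (rule AE_mp) (use R in \<open>auto simp: indicator_def of_bool_def if_distrib[of "\<lambda>c. c *\<^sub>R _"] sum.delta' cong: if_cong\<close>)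
  then have "(LINT x|\<sigma>. f x) = (LINT x|\<sigma>. (\<Sum>r\<in>R. indicator {r} x *\<^sub>R f r))"
    using f sing by (intro integral_cong_AE) auto
  also have "\<dots> = (\<Sum>r\<in>R. LINT x|\<sigma>. indicator {r} x *\<^sub>R f r)"
    using sing by (intro Bochner_Integration.integral_sum integrable_scaleR_left)
      (auto simp: integrable_indicator_iff less_top[symmetric])
  also have "\<dots> = (\<Sum>r\<in>R. measure \<sigma> {r} *\<^sub>R f r)"
    using sing R by (intro sum.cong) (auto simp: integral_scaleR_left integrable_indicator_iff less_top[symmetric])
  finally show ?thesis .
qed

text \<open>
  By linearity the sums vanish for \<open>z r ^ N * poly q (z r)\<close> with any polynomial \<open>q\<close>. Choosing \<open>q\<close> to
  vanish at all values of \<open>z\<close> other than \<open>z s\<close> isolates the total weight of the points with the value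
  \<open>z s\<close>. The \<open>z r\<close> may coincide; positivity keeps this total weight from cancelling.
\<close>

lemma positive_power_sums_zero_imp:
  fixes c :: "'a \<Rightarrow> real" and z :: "'a \<Rightarrow> complex"
  assumes R: "finite R" and c: "\<And>r. r \<in> R \<Longrightarrow> c r > 0"
    and sums: "\<And>m. m \<ge> N \<Longrightarrow> (\<Sum>r\<in>R. c r *\<^sub>R z r ^ m) = 0"
    and s: "s \<in> R"
  shows "z s = 0"
proof (rule ccontr)
  assume "z s \<noteq> 0"
  define q where "q = (\<Prod>y\<in>z ` R - {z s}. [:- y, 1:])"
  have q: "poly q (z s) \<noteq> 0" "\<And>r. r \<in> R \<Longrightarrow> z r \<noteq> z s \<Longrightarrow> poly q (z r) = 0"
    using R by (auto simp: q_def poly_prod)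
  have poly_sums: "(\<Sum>r\<in>R. c r *\<^sub>R (z r ^ N * poly q (z r))) = 0"
  proof -
    have "(\<Sum>r\<in>R. c r *\<^sub>R (z r ^ N * poly q (z r)))
        = (\<Sum>r\<in>R. \<Sum>i\<le>degree q. coeff q i * (c r *\<^sub>R z r ^ (N + i)))"
      by (intro sum.cong refl)
        (simp add: poly_altdef sum_distrib_left scaleR_sum_right power_add algebra_simps)
    also have "\<dots> = (\<Sum>i\<le>degree q. coeff q i * (\<Sum>r\<in>R. c r *\<^sub>R z r ^ (N + i)))"
      by (subst sum.swap) (simp add: sum_distrib_left)
    finally show ?thesis by (simp add: sums)
  qed
  let ?S = "{r \<in> R. z r = z s}"
  have "(\<Sum>r\<in>R. c r *\<^sub>R (z r ^ N * poly q (z r))) = (\<Sum>r\<in>?S. c r *\<^sub>R (z r ^ N * poly q (z r)))"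
    using R q(2) by (intro sum.mono_neutral_right) auto
  also have "\<dots> = (\<Sum>r\<in>?S. c r *\<^sub>R (z s ^ N * poly q (z s)))"
    by (intro sum.cong) auto
  also have "\<dots> = (\<Sum>r\<in>?S. c r) *\<^sub>R (z s ^ N * poly q (z s))"
    by (rule scaleR_sum_left[symmetric])
  finally have "(\<Sum>r\<in>?S. c r) = 0"
    using poly_sums q(1) \<open>z s \<noteq> 0\<close> by simp
  moreover have "(\<Sum>r\<in>?S. c r) > 0"
    using R c s by (intro sum_pos) auto
  ultimately show False by simp
qed

text \<open>
  Here the integral is a positive combination of the values at the atoms, so an element of the
  radical vanishes at all atoms, and hence so does every multiple of it.
\<close>

lemma mathieu_integral_kernel_finitely_atomic:
  assumes adm: "admissible_measure B \<sigma>" and "finitely_atomic \<sigma>"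
  shows "mathieu_subspace (integral_kernel \<sigma>)"
proof -
  interpret finite_measure \<sigma>
    using adm by (rule admissible_finite_measure)
  obtain R where R: "finite R" "R \<subseteq> space \<sigma>" and pos: "\<And>r. r \<in> R \<Longrightarrow> emeasure \<sigma> {r} > 0"
    and atomic: "\<And>U. U \<in> sets \<sigma> \<Longrightarrow> emeasure \<sigma> U = (\<Sum>r\<in>R \<inter> U. emeasure \<sigma> {r})"
    using assms(2) unfolding finitely_atomic_def by blast
  have int: "(LINT x|\<sigma>. poly g (complex_of_real x))
      = (\<Sum>r\<in>R. measure \<sigma> {r} *\<^sub>R poly g (complex_of_real r))" for g
    using admissible_integrable_poly[OF adm, of g]
    by (intro integral_finitely_atomic[OF adm R atomic]) auto
  have weight: "measure \<sigma> {r} > 0" if "r \<in> R" for r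
    using pos[OF that] by (simp add: emeasure_eq_measure)
  have "\<exists>N. \<forall>m\<ge>N. f ^ m * g \<in> integral_kernel \<sigma>" if f: "f \<in> radical_set (integral_kernel \<sigma>)" for f g
  proof -
    obtain N where N: "\<And>m. m \<ge> N \<Longrightarrow> f ^ m \<in> integral_kernel \<sigma>"
      using f by (auto simp: radical_set_def)
    have "(\<Sum>r\<in>R. measure \<sigma> {r} *\<^sub>R poly f (complex_of_real r) ^ m) = 0" if "m \<ge> N" for m
      using N[OF that] int[of "f ^ m"] by (simp add: integral_kernel_def poly_power)
    then have "poly f (complex_of_real r) = 0" if "r \<in> R" for r
      using positive_power_sums_zero_imp[where c = "\<lambda>r. measure \<sigma> {r}" and z = "\<lambda>r. poly f (complex_of_real r)"]
        R(1) weight that by blast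
    then have "\<forall>m\<ge>1. f ^ m * g \<in> integral_kernel \<sigma>"
      by (simp add: integral_kernel_def int poly_power power_0_left)
    then show ?thesis by blast
  qed
  then show ?thesis
    using subspace_integral_kernel[OF adm] by (simp add: mathieu_subspace_def)
qed

lemma mathieu_integral_kernel_iff_radical:
  assumes adm: "admissible_measure B \<sigma>"
  shows "mathieu_subspace (integral_kernel \<sigma>) \<longleftrightarrow>
    (\<not> finitely_atomic \<sigma> \<longrightarrow> radical_set (integral_kernel \<sigma>) = {0})"
proof
  assume M: "mathieu_subspace (integral_kernel \<sigma>)"
  show "\<not> finitely_atomic \<sigma> \<longrightarrow> radical_set (integral_kernel \<sigma>) = {0}"
  proof
    assume nonatomic: "\<not> finitely_atomic \<sigma>"
    have "f = 0" if f: "f \<in> radical_set (integral_kernel \<sigma>)" for f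
    proof (rule ccontr)
      assume "f \<noteq> 0"
      then have "f ^ N \<noteq> 0" for N by simp
      then show False
        using mathieu_radical_power_mem_multiplier_ideal[OF M f] nonatomic
          finitely_atomic_if_kernel_contains_ideal[OF adm] by blast
    qed
    then show "radical_set (integral_kernel \<sigma>) = {0}"
      using zero_mem_radical_set[OF subspace_integral_kernel[OF adm]] by blast
  qed
next
  assume strong: "\<not> finitely_atomic \<sigma> \<longrightarrow> radical_set (integral_kernel \<sigma>) = {0}"
  show "mathieu_subspace (integral_kernel \<sigma>)"
    using strong adm mathieu_integral_kernel_finitely_atomic subspace_integral_kernel
      mathieu_subspace_if_radical_trivial by blast
qed

section \<open>The two equivalences\<close>

theorem theorem5p6:
  shows "(integral_conjecture \<longleftrightarrow> strong_integral_conjecture) \<and>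
         (classical_image_conjecture \<longleftrightarrow> strong_classical_image_conjecture)"
proof
  show "integral_conjecture \<longleftrightarrow> strong_integral_conjecture"
    unfolding integral_conjecture_def strong_integral_conjecture_def
    using mathieu_integral_kernel_iff_radical by blast
  show "classical_image_conjecture \<longleftrightarrow> strong_classical_image_conjecture"
    by (rule classical_image_conjecture_iff_strong)
qed

end
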